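(* Let $X$ be a finite nonempty semimetric space. Then there are a finite ultrametric space $Y$ and a surjective ball-preserving function $F\colon Y\to X$ such that the mapping $$\mathbf{B}_Y\ni B\mapsto F(B)\in\mathbf{B}_X$$ is an arc-surjective homomorphism from the Hasse diagram $(\mathbf{B}_Y,A_Y)$ of the poset $(\mathbf{B}_Y,\subseteq)$ to the Hasse diagram $(\mathbf{B}_X,A_X)$ of the poset $(\mathbf{B}_X,\subseteq)$.
   Context: A semimetric on a set $X$ is a function $d\colon X\times X\to[0,\infty)$ with $d(x,y)=d(y,x)$ and $d(x,y)=0\Leftrightarrow x=y$ for all $x,y\in X$; then $(X,d)$ is a semimetric space. An ultrametric is a semimetric satisfying $d(x,y)\leqslant\max\{d(x,z),d(z,y)\}$ for all $x,y,z$. A closed ball in a semimetric space $(X,d)$ is a set of the form $B_r(t)=\{x\in X\colon d(x,t)\leqslant r\}$ with $t\in X$, $r\in[0,\infty)$. $\mathbf{B}_X$ denotes the set of all distinct closed balls of $X$ (as subsets of $X$). A mapping $F\colon X\to Y$ between semimetric spaces is ball-preserving if $F(Z)\in\mathbf{B}_Y$ for every $Z\in\mathbf{B}_X$, where $F(Z)$ is the image set. The Hasse diagram of a partially ordered set $(P,\leqslant)$ is the directed graph with vertex set $P$ in which $\langle v_1,v_2\rangle$ is an arc iff $v_1\leqslant v_2$, $v_1\neq v_2$, and for every $w\in P$, $v_1\leqslant w\leqslant v_2$ implies $w=v_1$ or $w=v_2$. A homomorphism from a directed graph $(V_1,A_1)$ to a directed graph $(V_2,A_2)$ is a map $H\colon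 V_1\to V_2$ such that $\langle u,v\rangle\in A_1$ implies $\langle H(u),H(v)\rangle\in A_2$. It is arc-surjective if for every $\langle x,y\rangle\in A_2$ there is $\langle u,v\rangle\in A_1$ with $\langle x,y\rangle=\langle H(u),H(v)\rangle$. *)

theory Defs
  imports Complex_Main "Graph_Theory.Pair_Digraph"
begin

text \<open>
  Spaces are given by a carrier set together with a distance function; the distance is
  only constrained on the carrier.
\<close>

locale semimetric_space =
  fixes X :: "'a set" and d :: "'a \<Rightarrow> 'a \<Rightarrow> real"
  assumes nonneg: "\<lbrakk>x \<in> X; y \<in> X\<rbrakk> \<Longrightarrow> 0 \<le> d x y"
    and commute: "\<lbrakk>x \<in> X; y \<in> X\<rbrakk> \<Longrightarrow> d x y = d y x"
    and zero_iff: "\<lbrakk>x \<in> X; y \<in> X\<rbrakk> \<Longrightarrow> d x y = 0 \<longleftrightarrow> x = y"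

locale ultrametric_space = semimetric_space X d
  for X :: "'a set" and d :: "'a \<Rightarrow> 'a \<Rightarrow> real" +
  assumes ultra: "\<lbrakk>x \<in> X; y \<in> X; z \<in> X\<rbrakk> \<Longrightarrow> d x y \<le> max (d x z) (d z y)"

definition closed_ball :: "'a set \<Rightarrow> ('a \<Rightarrow> 'a \<Rightarrow> real) \<Rightarrow> 'a \<Rightarrow> real \<Rightarrow> 'a set" where
  "closed_ball X d t r = {x \<in> X. d x t \<le> r}"

definition closed_balls :: "'a set \<Rightarrow> ('a \<Rightarrow> 'a \<Rightarrow> real) \<Rightarrow> 'a set set" where
  "closed_balls X d = {closed_ball X d t r | t r. t \<in> X \<and> 0 \<le> r}"

definition ball_preserving ::
  "'a set \<Rightarrow> ('a \<Rightarrow> 'a \<Rightarrow> real) \<Rightarrow> 'b set \<Rightarrow> ('b \<Rightarrow> 'b \<Rightarrow> real) \<Rightarrow> ('a \<Rightarrow> 'b) \<Rightarrow> bool" where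
  "ball_preserving X d Y e F \<longleftrightarrow>
     F ` X \<subseteq> Y \<and> (\<forall>Z \<in> closed_balls X d. F ` Z \<in> closed_balls Y e)"

definition hasse_diagram :: "'a set \<Rightarrow> ('a \<Rightarrow> 'a \<Rightarrow> bool) \<Rightarrow> 'a pair_pre_digraph" where
  "hasse_diagram P le =
     \<lparr>pverts = P,
      parcs = {(u, v). u \<in> P \<and> v \<in> P \<and> le u v \<and> u \<noteq> v \<and>
                       (\<forall>w \<in> P. le u w \<and> le w v \<longrightarrow> w = u \<or> w = v)}\<rparr>"

definition digraph_hom ::
  "'a pair_pre_digraph \<Rightarrow> 'b pair_pre_digraph \<Rightarrow> ('a \<Rightarrow> 'b) \<Rightarrow> bool" where
  "digraph_hom G G' H \<longleftrightarrow>
     (\<forall>v \<in> pverts G. H v \<in> pverts G') \<and>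
     (\<forall>u v. (u, v) \<in> parcs G \<longrightarrow> (H u, H v) \<in> parcs G')"

definition arc_surjective ::
  "'a pair_pre_digraph \<Rightarrow> 'b pair_pre_digraph \<Rightarrow> ('a \<Rightarrow> 'b) \<Rightarrow> bool" where
  "arc_surjective G G' H \<longleftrightarrow>
     (\<forall>x y. (x, y) \<in> parcs G' \<longrightarrow> (\<exists>u v. (u, v) \<in> parcs G \<and> (x, y) = (H u, H v)))"

text \<open>
  HOL cannot quantify existentially over types. A finite ultrametric space whose
  existence is claimed is therefore taken with a carrier of type \<^typ>\<open>nat set\<close>,
  which loses no generality: every finite space is isometric to one of this form.
\<close>

end

(* The points of Y are the maximal chains of B_X, listed downwards from X to a singleton, and two
   of them are the closer the longer their common initial segment. The balls of Y then correspond
   to the saturated chains starting at X, which form a tree. A ball of X that is not a singleton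
   covers at least two balls, so every inner node branches, distinct nodes give distinct balls and
   arcs are one-step extensions. F sends a maximal chain to the element of its last member, and
   it maps the ball of a node to the last member of that node. *)

theory Submission
  imports Defs "HOL-Library.Sublist"
begin

text \<open>The construction of the tree and of Y draws on these properties of the family of balls;
  the distance of X enters when they are verified.\<close>

locale set_family =
  fixes X :: "'a set" and \<B> :: "'a set set"
  assumes finite_X: "finite X"
    and X_in: "X \<in> \<B>"
    and sub: "B \<in> \<B> \<Longrightarrow> B \<subseteq> X"
    and nonempty: "B \<in> \<B> \<Longrightarrow> B \<noteq> {}"
    and singleton_in: "x \<in> X \<Longrightarrow> {x} \<in> \<B>"
begin

section \<open>Covering pairs of the family\<close>

definition covered :: "'a set \<Rightarrow> 'a set \<Rightarrow> bool" where
  "covered C B \<longleftrightarrow> (C, B) \<in> parcs (hasse_diagram \<B> (\<subseteq>))"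

lemma covered_iff:
  "covered C B \<longleftrightarrow>
     C \<in> \<B> \<and> B \<in> \<B> \<and> C \<subset> B \<and> (\<forall>D\<in>\<B>. C \<subseteq> D \<and> D \<subseteq> B \<longrightarrow> D = C \<or> D = B)"
  by (auto simp: covered_def hasse_diagram_def)

lemma finite_family: "finite \<B>"
  using sub finite_X by (auto intro: finite_subset[of _ "Pow X"])

lemma finite_member: "B \<in> \<B> \<Longrightarrow> finite B"
  using sub finite_X finite_subset by blast

text \<open>A maximal member among those that contain x and lie properly inside B is a lower cover;
  \<open>{x}\<close> is a candidate. Keeping x in the cover lets a chain be steered to a prescribed
  point.\<close>

lemma ex_lower_cover:
  assumes "B \<in> \<B>" "x \<in> B" "B \<noteq> {x}"
  obtains C where "covered C B" "x \<in> C"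
proof -
  let ?S = "{C \<in> \<B>. x \<in> C \<and> C \<subset> B}"
  have "{x} \<in> ?S"
    using assms sub singleton_in by blast
  then obtain C where C: "C \<in> ?S" and max: "\<And>D. D \<in> ?S \<Longrightarrow> C \<subseteq> D \<Longrightarrow> C = D"
    using finite_has_maximal[of ?S] finite_family by auto
  have "D = C \<or> D = B" if "D \<in> \<B>" "C \<subseteq> D" "D \<subseteq> B" for D
    using max[of D] C that by blast
  with C assms show thesis
    by (intro that[of C]) (auto simp: covered_iff)
qed

lemma ex_upper_cover:
  assumes "B \<in> \<B>" "B \<noteq> X"
  obtains C where "covered B C"
proof -
  let ?S = "{C \<in> \<B>. B \<subset> C}"
  have "X \<in> ?S"
    using assms sub X_in by blast
  then obtain C where C: "C \<in> ?S" and min: "\<And>D. D \<in> ?S \<Longrightarrow> D \<subseteq> C \<Longrightarrow> C = D"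
    using finite_has_minimal[of ?S] finite_family by auto
  have "D = B \<or> D = C" if "D \<in> \<B>" "B \<subseteq> D" "D \<subseteq> C" for D
    using min[of D] C that by blast
  with C assms show thesis
    by (intro that[of C]) (auto simp: covered_iff)
qed

section \<open>The tree of saturated chains that start at X\<close>

inductive descent :: "'a set list \<Rightarrow> bool" where
  top: "descent [X]"
| step: "descent p \<Longrightarrow> covered C (last p) \<Longrightarrow> descent (p @ [C])"

lemma descent_nonempty: "descent p \<Longrightarrow> p \<noteq> []"
  by (erule descent.cases) auto

lemma descent_last_in: "descent p \<Longrightarrow> last p \<in> \<B>"
  by (erule descent.cases) (auto simp: X_in covered_iff)

text \<open>New sets are appended at the end, so the tree order is the prefix order; the empty list
  is no node.\<close>

lemma descent_prefix: "descent p \<Longrightarrow> prefix q p \<Longrightarrow> q \<noteq> [] \<Longrightarrow> descent q"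
  by (induction rule: descent.induct) (auto simp: prefix_Cons intro: descent.intros)

lemma descent_hd: "descent p \<Longrightarrow> hd p = X"
  by (induction rule: descent.induct) (auto simp: hd_append descent_nonempty)

lemma descent_snocD: "descent (p @ [C]) \<Longrightarrow> p \<noteq> [] \<Longrightarrow> covered C (last p)"
  by (erule descent.cases) auto

lemma descent_strict_mono:
  "descent q \<Longrightarrow> strict_prefix p q \<Longrightarrow> p \<noteq> [] \<Longrightarrow> last q \<subset> last p"
proof (induction arbitrary: p rule: descent.induct)
  case top
  then show ?case by (auto simp: strict_prefix_def prefix_Cons)
next
  case (step q C)
  then have "prefix p q"
    by (auto simp: strict_prefix_def)
  moreover have "C \<subset> last q"
    using step.hyps by (simp add: covered_iff)
  ultimately show ?case
    using step.IH[of p] step.prems by (cases "p = q") (auto simp: strict_prefix_def)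
qed

text \<open>Each step costs at least one element of the last set, so the sum never grows. This
  bounds the depth of the tree, which is therefore finite.\<close>

lemma descent_bounds: "descent p \<Longrightarrow> set p \<subseteq> \<B> \<and> length p + card (last p) \<le> card X + 1"
proof (induction rule: descent.induct)
  case top
  then show ?case by (simp add: X_in)
next
  case (step p C)
  then have "card C < card (last p)"
    by (intro psubset_card_mono) (auto simp: covered_iff finite_member)
  with step show ?case by (auto simp: covered_iff)
qed

lemma finite_descents: "finite {p. descent p}"
proof (rule finite_subset)
  show "{p. descent p} \<subseteq> {p. set p \<subseteq> \<B> \<and> length p \<le> card X + 1}"
    using descent_bounds by fastforce
  show "finite {p. set p \<subseteq> \<B> \<and> length p \<le> card X + 1}"
    by (rule finite_lists_length_le[OF finite_family])
qed

text \<open>The chain is built upwards: a chain that ends in an upper cover of B is prolonged by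
  B.\<close>

lemma ex_descent_to: "B \<in> \<B> \<Longrightarrow> \<exists>p. descent p \<and> last p = B"
proof (induction "card X - card B" arbitrary: B rule: less_induct)
  case less
  show ?case
  proof (cases "B = X")
    case True
    then show ?thesis using descent.top by (intro exI[of _ "[X]"]) auto
  next
    case False
    then obtain C where C: "covered B C"
      using ex_upper_cover less.prems by blast
    then have CB: "C \<in> \<B>" "B \<subset> C" by (auto simp: covered_iff)
    then have "card B < card C" "card C \<le> card X"
      using finite_member[OF CB(1)] sub[OF CB(1)] finite_X psubset_card_mono card_mono
      by blast+
    then obtain p where "descent p" "last p = C"
      using less.hyps[of C] CB by force
    then show ?thesis
      using C descent.step by (intro exI[of _ "p @ [B]"]) auto
  qed
qed

section \<open>Chains that end in a singleton, the leaves of the tree\<close>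

definition leaves :: "'a set list set" where
  "leaves = {p. descent p \<and> (\<exists>x. last p = {x})}"

lemma finite_leaves: "finite leaves"
  using finite_descents by (rule rev_finite_subset) (auto simp: leaves_def)

lemma leaf_descent: "p \<in> leaves \<Longrightarrow> descent p"
  by (simp add: leaves_def)

text \<open>As long as the last set is not \<open>{x}\<close>, it has a lower cover that still
  contains x and has fewer elements.\<close>

lemma ex_leaf_above:
  "descent p \<Longrightarrow> x \<in> last p \<Longrightarrow> \<exists>q. q \<in> leaves \<and> prefix p q \<and> last q = {x}"
proof (induction "card (last p)" arbitrary: p rule: less_induct)
  case less
  show ?case
  proof (cases "last p = {x}")
    case True
    then show ?thesis using less.prems by (auto simp: leaves_def)
  next
    case False
    then obtain C where C: "covered C (last p)" "x \<in> C"
      using ex_lower_cover less.prems descent_last_in by metis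
    then have "card C < card (last p)"
      by (intro psubset_card_mono) (auto simp: covered_iff finite_member)
    then obtain q where "q \<in> leaves" "prefix (p @ [C]) q" "last q = {x}"
      using less.hyps[of "p @ [C]"] less.prems C descent.step by auto
    then show ?thesis using append_prefixD by blast
  qed
qed

text \<open>A proper extension would end in a proper subset of a singleton, but members of the
  family are nonempty.\<close>

lemma leaf_maximal:
  assumes "p \<in> leaves" "descent q" "prefix p q"
  shows "q = p"
proof (rule ccontr)
  assume "q \<noteq> p"
  then have "last q \<subset> last p"
    using assms leaf_descent descent_nonempty
    by (intro descent_strict_mono) (auto simp: strict_prefix_def)
  then show False
    using assms descent_last_in nonempty by (fastforce simp: leaves_def)
qed

text \<open>Both chains start with X, so their common segment is nonempty and hence a node, the last
  common ancestor.\<close>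

lemma descent_lcp:
  assumes "descent p" "descent q"
  shows "descent (longest_common_prefix p q)"
proof -
  obtain p' q' where "p = X # p'" "q = X # q'"
    using assms descent_hd descent_nonempty by (metis list.collapse)
  then have "longest_common_prefix p q \<noteq> []" by simp
  then show ?thesis
    using descent_prefix[OF assms(1)] longest_common_prefix_prefix1 by blast
qed

end

section \<open>The labelled leaves, and the cone of leaves through a node\<close>

locale numbered_leaves = set_family X \<B> for X :: "'a set" and \<B> +
  fixes Y :: "'i set" and g :: "'i \<Rightarrow> 'a set list"
  assumes bij: "bij_betw g Y leaves"
begin

text \<open>The case \<open>m = n\<close> is separate because a leaf shares a segment of positive
  length with itself, which would give a positive value.\<close>

definition dst :: "'i \<Rightarrow> 'i \<Rightarrow> real" where
  "dst m n = (if m = n then 0 else 1 / length (longest_common_prefix (g m) (g n)))"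

definition F :: "'i \<Rightarrow> 'a" where
  "F n = the_elem (last (g n))"

text \<open>These sets will be the balls of Y.\<close>

definition cone :: "'a set list \<Rightarrow> 'i set" where
  "cone p = {n \<in> Y. prefix p (g n)}"

lemma g_leaf: "n \<in> Y \<Longrightarrow> g n \<in> leaves"
  using bij by (auto simp: bij_betw_def)

lemma g_descent: "n \<in> Y \<Longrightarrow> descent (g n)"
  using g_leaf leaf_descent by blast

lemma g_inj: "m \<in> Y \<Longrightarrow> n \<in> Y \<Longrightarrow> g m = g n \<Longrightarrow> m = n"
  using bij by (auto simp: bij_betw_def inj_on_def)

lemma last_g: "n \<in> Y \<Longrightarrow> last (g n) = {F n}"
  using g_leaf by (fastforce simp: leaves_def F_def)

lemma ex_in_cone:
  assumes "descent p" "x \<in> last p"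
  obtains n where "n \<in> cone p" "F n = x"
proof -
  obtain q where q: "q \<in> leaves" "prefix p q" "last q = {x}"
    using ex_leaf_above assms by blast
  then obtain n where "n \<in> Y" "g n = q"
    using bij by (metis bij_betw_def imageE)
  with q show thesis
    by (intro that[of n]) (auto simp: cone_def F_def)
qed

lemma cone_nonempty: "descent p \<Longrightarrow> cone p \<noteq> {}"
  using descent_last_in nonempty ex_in_cone by (metis all_not_in_conv)

text \<open>A leaf through p ends in a singleton inside \<open>last p\<close>, since sets shrink
  along a chain; conversely each point of \<open>last p\<close> is the end of some leaf through
  p.\<close>

lemma F_image_cone:
  assumes "descent p"
  shows "F ` cone p = last p"
proof
  show "F ` cone p \<subseteq> last p"
  proof safe
    fix n assume "n \<in> cone p"
    then have n: "n \<in> Y" "prefix p (g n)" by (auto simp: cone_def)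
    then have "last (g n) \<subseteq> last p"
      using descent_strict_mono[OF g_descent, of n p] descent_nonempty[OF assms]
      by (cases "p = g n") (auto simp: strict_prefix_def)
    then show "F n \<in> last p" using last_g n by auto
  qed
  show "last p \<subseteq> F ` cone p"
    using ex_in_cone[OF assms] by (metis imageI subsetI)
qed

lemma cone_mono: "prefix p q \<Longrightarrow> cone q \<subseteq> cone p"
  using prefix_order.trans by (auto simp: cone_def)

text \<open>The branching of the tree is seen through F: an inclusion of the cones would give
  \<open>last p \<subseteq> last q\<close>, against the strict decrease along the chain.\<close>

lemma cone_not_subset:
  assumes "descent q" "strict_prefix p q" "p \<noteq> []"
  shows "\<not> cone p \<subseteq> cone q"
proof
  assume "cone p \<subseteq> cone q"
  moreover have p: "descent p"
    using assms descent_prefix by (auto simp: strict_prefix_def)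
  ultimately have "last p \<subseteq> last q"
    using F_image_cone assms(1) by (metis image_mono)
  then show False
    using descent_strict_mono[OF assms] by blast
qed

text \<open>Two nodes with a common leaf lie on one branch, and \<open>cone_not_subset\<close>
  excludes the wrong order.\<close>

lemma cone_subset_iff:
  assumes "descent p" "descent q"
  shows "cone q \<subseteq> cone p \<longleftrightarrow> prefix p q"
proof
  assume sub: "cone q \<subseteq> cone p"
  obtain n where "n \<in> cone q" using cone_nonempty assms by blast
  with sub have "prefix q (g n)" "prefix p (g n)" by (auto simp: cone_def)
  then consider "prefix p q" | "strict_prefix q p"
    using prefix_same_cases strict_prefixI by blast
  then show "prefix p q"
  proof cases
    case 2
    then show ?thesis
      using cone_not_subset[OF assms(1) 2] sub descent_nonempty[OF assms(2)] by blast
  qed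
qed (rule cone_mono)

lemma cone_eq_iff: "descent p \<Longrightarrow> descent q \<Longrightarrow> cone p = cone q \<longleftrightarrow> p = q"
  by (auto simp: set_eq_subset cone_subset_iff intro: prefix_order.antisym)

lemma cone_leaf:
  assumes "t \<in> Y"
  shows "cone (g t) = {t}"
proof -
  have "n = t" if n: "n \<in> Y" "prefix (g t) (g n)" for n
  proof -
    have "g n = g t"
      using leaf_maximal g_leaf[OF assms] g_descent[OF n(1)] n(2) by simp
    then show ?thesis using g_inj n(1) assms by simp
  qed
  then show ?thesis using assms unfolding cone_def by auto
qed

section \<open>The ultrametric on the leaves and its balls\<close>

lemma dst_le:
  assumes "m \<in> Y" "n \<in> Y" "prefix p (g m)" "prefix p (g n)" "p \<noteq> []"
  shows "dst m n \<le> 1 / length p"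
proof -
  have "length p \<le> length (longest_common_prefix (g m) (g n))"
    using assms(3,4) by (intro prefix_length_le longest_common_prefix_max_prefix)
  with assms show ?thesis
    by (cases p) (auto simp: dst_def frac_le)
qed

text \<open>The node p and the common segment of \<open>g m\<close> and \<open>g n\<close> are both
  prefixes of \<open>g n\<close>, so comparing their lengths decides which is a prefix of the
  other.\<close>

lemma dst_le_iff:
  assumes "m \<in> Y" "n \<in> Y" "prefix p (g n)" "p \<noteq> []"
  shows "dst m n \<le> 1 / length p \<longleftrightarrow> prefix p (g m)"
proof
  assume le: "dst m n \<le> 1 / length p"
  let ?l = "longest_common_prefix (g m) (g n)"
  show "prefix p (g m)"
  proof (cases "m = n")
    case False
    \<comment> \<open>As \<open>1 / 0\<close> is 0, the inequality of reciprocals can be inverted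
      only once the length is known to be positive.\<close>
    have "?l \<noteq> []"
      using descent_lcp[THEN descent_nonempty] g_descent assms(1,2) by simp
    then have "length p \<le> length ?l"
      using le False assms by (simp add: dst_def field_simps)
    then have "prefix p ?l"
      using prefix_length_prefix[OF assms(3) longest_common_prefix_prefix2] by simp
    then show ?thesis
      by (rule prefix_order.trans[OF _ longest_common_prefix_prefix1])
  qed (use assms in simp)
qed (rule dst_le[OF assms(1,2) _ assms(3,4)])

lemma dst_commute: "dst m n = dst n m"
proof -
  have "longest_common_prefix p q = longest_common_prefix q p" for p q :: "'a set list"
    by (intro prefix_order.antisym longest_common_prefix_max_prefix
        longest_common_prefix_prefix1 longest_common_prefix_prefix2)
  then show ?thesis by (simp add: dst_def)
qed

lemma dst_lcp: "m \<noteq> n \<Longrightarrow> dst m n = 1 / length (longest_common_prefix (g m) (g n))"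
  by (simp add: dst_def)

text \<open>The segments that z shares with x and with y are prefixes of \<open>g z\<close>, so one
  is a prefix of the other; the shorter one is then shared by x and y.\<close>

lemma ultrametric: "ultrametric_space Y dst"
proof
  fix x y assume xy: "x \<in> Y" "y \<in> Y"
  then have "longest_common_prefix (g x) (g y) \<noteq> []"
    using descent_lcp[THEN descent_nonempty] g_descent by simp
  then show "dst x y = 0 \<longleftrightarrow> x = y" "0 \<le> dst x y"
    by (auto simp: dst_def)
  show "dst x y = dst y x" by (rule dst_commute)
  fix z assume z: "z \<in> Y"
  let ?p = "longest_common_prefix (g x) (g z)" and ?q = "longest_common_prefix (g z) (g y)"
  show "dst x y \<le> max (dst x z) (dst z y)"
  proof (cases "x = z \<or> z = y")
    case False
    have ne: "?p \<noteq> []" "?q \<noteq> []"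
      using descent_lcp[THEN descent_nonempty] g_descent xy z by simp_all
    have pre: "prefix ?p (g x)" "prefix ?p (g z)" "prefix ?q (g z)" "prefix ?q (g y)"
      by (simp_all add: longest_common_prefix_prefix1 longest_common_prefix_prefix2)
    then consider "prefix ?p ?q" | "prefix ?q ?p"
      using prefix_same_cases by blast
    then show ?thesis
    proof cases
      case 1
      then have "dst x y \<le> 1 / length ?p"
        using prefix_order.trans[OF 1 pre(4)] pre(1) ne(1) xy by (intro dst_le)
      then show ?thesis using False by (simp add: dst_lcp le_max_iff_disj)
    next
      case 2
      then have "dst x y \<le> 1 / length ?q"
        using prefix_order.trans[OF 2 pre(1)] pre(4) ne(2) xy by (intro dst_le)
      then show ?thesis using False by (simp add: dst_lcp le_max_iff_disj)
    qed
  qed auto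
qed

text \<open>Every leaf in the cone serves as a centre; the radius depends on the depth of p
  alone.\<close>

lemma cone_eq_ball:
  assumes "descent p" "t \<in> cone p"
  shows "cone p = closed_ball Y dst t (1 / length p)"
  using assms dst_le_iff[of _ t p] descent_nonempty[OF assms(1)]
  unfolding cone_def closed_ball_def by blast

text \<open>The node p is the highest one above t whose cone stays in the ball. For another point n
  of the ball, the common segment of n and t is also such a node, because its cone is the ball
  around t of radius \<open>dst n t\<close>; so p is a prefix of it.\<close>

lemma ball_is_cone:
  assumes t: "t \<in> Y" and r: "0 \<le> r"
  obtains p where "descent p" "closed_ball Y dst t r = cone p"
proof -
  let ?B = "closed_ball Y dst t r"
  let ?Q = "\<lambda>p. prefix p (g t) \<and> p \<noteq> [] \<and> cone p \<subseteq> ?B"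
  \<comment> \<open>The leaf itself is a candidate: its cone is \<open>{t}\<close>, inside even the
    ball of radius 0.\<close>
  have "?Q (g t)"
    using cone_leaf[OF t] t r descent_nonempty[OF g_descent[OF t]]
    by (simp add: closed_ball_def dst_def)
  then obtain p where p: "?Q p" and min: "\<And>q. ?Q q \<Longrightarrow> length p \<le> length q"
    using ex_has_least_nat[of ?Q "g t" length] by blast
  have "n \<in> cone p" if n: "n \<in> ?B" for n
  proof (cases "n = t")
    case True
    then show ?thesis using p t by (simp add: cone_def)
  next
    case False
    let ?l = "longest_common_prefix (g n) (g t)"
    have nY: "n \<in> Y" and "dst n t \<le> r" using n by (auto simp: closed_ball_def)
    then have le: "1 / length ?l \<le> r" using False by (simp add: dst_lcp)
    have l: "prefix ?l (g n)" "prefix ?l (g t)" "descent ?l"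
      using descent_lcp g_descent nY t
      by (auto simp: longest_common_prefix_prefix1 longest_common_prefix_prefix2)
    then have "cone ?l = closed_ball Y dst t (1 / length ?l)"
      using t by (intro cone_eq_ball) (auto simp: cone_def)
    also have "\<dots> \<subseteq> ?B" using le by (auto simp: closed_ball_def)
    finally have "length p \<le> length ?l"
      using min l descent_nonempty by blast
    then have "prefix p ?l"
      using p l prefix_length_prefix by blast
    then show ?thesis
      using l nY prefix_order.trans by (auto simp: cone_def)
  qed
  then have "?B = cone p" using p by blast
  moreover have "descent p" using p descent_prefix g_descent t by blast
  ultimately show thesis using that by blast
qed

lemma balls_eq_cones: "closed_balls Y dst = cone ` {p. descent p}"
proof
  show "closed_balls Y dst \<subseteq> cone ` {p. descent p}"
  proof
    fix B assume "B \<in> closed_balls Y dst"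
    then obtain t r where "t \<in> Y" "0 \<le> r" "B = closed_ball Y dst t r"
      by (auto simp: closed_balls_def)
    then show "B \<in> cone ` {p. descent p}"
      using ball_is_cone by (metis image_eqI mem_Collect_eq)
  qed
  show "cone ` {p. descent p} \<subseteq> closed_balls Y dst"
  proof safe
    fix p assume p: "descent p"
    then obtain t where t: "t \<in> cone p" using cone_nonempty by blast
    then have "t \<in> Y" by (simp add: cone_def)
    moreover have "cone p = closed_ball Y dst t (1 / length p)"
      using cone_eq_ball p t by blast
    moreover have "(0::real) \<le> 1 / length p" by simp
    ultimately show "cone p \<in> closed_balls Y dst"
      unfolding closed_balls_def by blast
  qed
qed

section \<open>Arcs of the two Hasse diagrams\<close>

lemma cone_arc_iff:
  assumes p: "descent p" and q: "descent q"
  shows "(cone q, cone p) \<in> parcs (hasse_diagram (closed_balls Y dst) (\<subseteq>)) \<longleftrightarrow>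
         (\<exists>C. q = p @ [C])"
proof -
  \<comment> \<open>Balls ordered by inclusion are the nodes in reversed prefix order, so an arc is
    a pair of nodes with none strictly between.\<close>
  have "(cone q, cone p) \<in> parcs (hasse_diagram (closed_balls Y dst) (\<subseteq>)) \<longleftrightarrow>
      prefix p q \<and> q \<noteq> p \<and> (\<forall>w. descent w \<and> prefix w q \<and> prefix p w \<longrightarrow> w = q \<or> w = p)"
    using p q by (auto simp: hasse_diagram_def balls_eq_cones cone_subset_iff cone_eq_iff)
  also have "\<dots> \<longleftrightarrow> (\<exists>C. q = p @ [C])"
  proof safe
    assume pq: "prefix p q" "q \<noteq> p"
      and min: "\<forall>w. descent w \<and> prefix w q \<and> prefix p w \<longrightarrow> w = q \<or> w = p"
    then obtain C r where r: "q = p @ C # r"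
      by (metis append_Nil2 neq_Nil_conv prefix_def)
    \<comment> \<open>The node one step below p on the way to q lies between the two, hence equals
      q.\<close>
    then have "prefix (p @ [C]) q" by simp
    moreover from this have "descent (p @ [C])" using descent_prefix[OF q] by blast
    ultimately have "p @ [C] = q"
      using min by (metis prefixI not_Cons_self2 self_append_conv)
    then show "\<exists>C. q = p @ [C]" by blast
  next
    fix C w assume "prefix w (p @ [C])" "prefix p w" "w \<noteq> p"
    then show "w = p @ [C]" by (auto simp: prefix_order.antisym)
  qed auto
  finally show ?thesis .
qed

text \<open>An arc appends one set to a node, and in a chain that set is covered by the one before
  it.\<close>

lemma F_hom:
  "digraph_hom (hasse_diagram (closed_balls Y dst) (\<subseteq>)) (hasse_diagram \<B> (\<subseteq>)) (\<lambda>B. F ` B)"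
  unfolding digraph_hom_def
proof safe
  fix B assume "B \<in> pverts (hasse_diagram (closed_balls Y dst) (\<subseteq>))"
  then show "F ` B \<in> pverts (hasse_diagram \<B> (\<subseteq>))"
    using F_image_cone descent_last_in by (auto simp: hasse_diagram_def balls_eq_cones)
next
  fix U V assume arc: "(U, V) \<in> parcs (hasse_diagram (closed_balls Y dst) (\<subseteq>))"
  then have "U \<in> closed_balls Y dst" "V \<in> closed_balls Y dst"
    by (auto simp: hasse_diagram_def)
  then obtain p q where pq: "descent p" "descent q" "U = cone q" "V = cone p"
    by (auto simp: balls_eq_cones)
  then obtain C where "q = p @ [C]" using arc cone_arc_iff by blast
  then have "covered (last q) (last p)"
    using pq descent_snocD descent_nonempty by auto
  then show "(F ` U, F ` V) \<in> parcs (hasse_diagram \<B> (\<subseteq>))"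
    using pq F_image_cone by (simp add: covered_def)
qed

text \<open>Some node ends in the upper set B of the arc; appending the lower set C gives an arc
  that is mapped to it.\<close>

lemma F_arc_surjective:
  "arc_surjective (hasse_diagram (closed_balls Y dst) (\<subseteq>)) (hasse_diagram \<B> (\<subseteq>)) (\<lambda>B. F ` B)"
  unfolding arc_surjective_def
proof safe
  fix C B assume "(C, B) \<in> parcs (hasse_diagram \<B> (\<subseteq>))"
  then have CB: "covered C B" by (simp add: covered_def)
  then have "B \<in> \<B>" by (simp add: covered_iff)
  then obtain p where p: "descent p" "last p = B"
    using ex_descent_to by blast
  with CB have q: "descent (p @ [C])" by (simp add: descent.step)
  have "(cone (p @ [C]), cone p) \<in> parcs (hasse_diagram (closed_balls Y dst) (\<subseteq>))"
    using cone_arc_iff p q by blast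
  moreover have "(C, B) = (F ` cone (p @ [C]), F ` cone p)"
    using F_image_cone p q by simp
  ultimately show "\<exists>U V. (U, V) \<in> parcs (hasse_diagram (closed_balls Y dst) (\<subseteq>)) \<and>
      (C, B) = (F ` U, F ` V)" by blast
qed

lemma F_image: "F ` Y = X"
proof -
  have "prefix [X] (g n)" if "n \<in> Y" for n
    using descent_hd[OF g_descent[OF that]] descent_nonempty[OF g_descent[OF that]]
    by (cases "g n") auto
  then have "cone [X] = Y" by (auto simp: cone_def)
  then show ?thesis using F_image_cone[OF descent.top] by simp
qed

end

section \<open>The closed balls of a finite semimetric space\<close>

lemma (in semimetric_space) set_family_closed_balls:
  assumes "finite X" "X \<noteq> {}"
  shows "set_family X (closed_balls X d)"
proof
  obtain t where t: "t \<in> X" using assms by blast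
  \<comment> \<open>The largest distance from t, so that the ball around t is the whole of
    X.\<close>
  define r where "r = Max ((\<lambda>x. d x t) ` X)"
  have r: "d x t \<le> r" if "x \<in> X" for x
    using that assms by (simp add: r_def)
  then have "X = closed_ball X d t r" "0 \<le> r"
    using nonneg[OF t t] r[OF t] by (auto simp: closed_ball_def)
  then show "X \<in> closed_balls X d"
    unfolding closed_balls_def using t by blast
next
  fix B assume "B \<in> closed_balls X d"
  then obtain t r where tr: "t \<in> X" "0 \<le> r" "B = closed_ball X d t r"
    by (auto simp: closed_balls_def)
  then show "B \<subseteq> X" by (auto simp: closed_ball_def)
  have "t \<in> B" using tr zero_iff[of t t] by (simp add: closed_ball_def)
  then show "B \<noteq> {}" by blast
next
  fix x assume x: "x \<in> X"
  then have "{x} = closed_ball X d x 0"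
    using zero_iff nonneg by (force simp: closed_ball_def)
  then show "{x} \<in> closed_balls X d"
    unfolding closed_balls_def using x by blast
qed (rule assms)

theorem theorem4p4:
  fixes X :: "'a set" and d :: "'a \<Rightarrow> 'a \<Rightarrow> real"
  assumes "semimetric_space X d" and "finite X" and "X \<noteq> {}"
  shows "\<exists>(Y :: nat set) (e :: nat \<Rightarrow> nat \<Rightarrow> real) (F :: nat \<Rightarrow> 'a).
           ultrametric_space Y e \<and> finite Y \<and>
           F ` Y = X \<and> ball_preserving Y e X d F \<and>
           digraph_hom (hasse_diagram (closed_balls Y e) (\<subseteq>))
                       (hasse_diagram (closed_balls X d) (\<subseteq>)) (\<lambda>B. F ` B) \<and>
           arc_surjective (hasse_diagram (closed_balls Y e) (\<subseteq>))
                          (hasse_diagram (closed_balls X d) (\<subseteq>)) (\<lambda>B. F ` B)"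
proof -
  interpret set_family X "closed_balls X d"
    using semimetric_space.set_family_closed_balls assms .
  \<comment> \<open>Numbering the finitely many leaves gives Y a carrier of natural numbers.\<close>
  obtain g where g: "bij_betw g {0..<card leaves} leaves"
    using ex_bij_betw_nat_finite[OF finite_leaves] by blast
  interpret numbered_leaves X "closed_balls X d" "{0..<card leaves}" g
    using g by unfold_locales
  \<comment> \<open>This is the vertex part of \<open>F_hom\<close>, together with
    \<open>F_image\<close>.\<close>
  have "ball_preserving {0..<card leaves} dst X d F"
    using F_image F_hom
    by (auto simp: ball_preserving_def digraph_hom_def hasse_diagram_def)
  then show ?thesis
    using ultrametric F_image F_hom F_arc_surjective by (meson finite_atLeastLessThan)
qed

end
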